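(* Let $S$ be an intra-regular $\Gamma$-AG$^{\ast\ast}$-groupoid and let $A=(\mu_A,\gamma_A)$ be an intuitionistic fuzzy set of $S$. Then the following statements are equivalent. (i) $A$ is an intuitionistic fuzzy $\Gamma$-left ideal of $S$. (ii) $A$ is an intuitionistic fuzzy $\Gamma$-right ideal of $S$. (iii) $A$ is an intuitionistic fuzzy $\Gamma$-two-sided ideal of $S$. (iv) $A$ is an intuitionistic fuzzy $\Gamma$-bi-ideal of $S$. (v) $A$ is an intuitionistic fuzzy $\Gamma$-generalized bi-ideal of $S$. (vi) $A$ is an intuitionistic fuzzy $\Gamma$-interior ideal of $S$. (vii) $A$ is an intuitionistic fuzzy $\Gamma$-quasi ideal of $S$. (viii) $A\circ_\Gamma\delta=A$ and $\delta\circ_\Gamma A=A$.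
   Context: Let $S,\Gamma$ be nonempty sets with a map $S\times\Gamma\times S\to S$, $(x,\alpha,y)\mapsto x\alpha y$. $S$ is a $\Gamma$-AG-groupoid if $(x\alpha y)\beta z=(z\alpha y)\beta x$ for all $x,y,z\in S$, $\alpha,\beta\in\Gamma$. It is a $\Gamma$-AG$^{\ast\ast}$-groupoid if moreover $x\alpha(y\beta z)=y\alpha(x\beta z)$ for all $x,y,z\in S$, $\alpha,\beta\in\Gamma$. $S$ is intra-regular if for every $a\in S$ there exist $x,y\in S$ and $\alpha,\beta,\gamma\in\Gamma$ with $a=(x\alpha(a\beta a))\gamma y$. An intuitionistic fuzzy set (IFS) of $S$ is a pair $A=(\mu_A,\gamma_A)$ of functions $\mu_A,\gamma_A:S\to[0,1]$ with $0\le\mu_A(x)+\gamma_A(x)\le1$ for all $x\in S$. Let $\delta=(S_\delta,\Theta_\delta)$ be the IFS with $S_\delta(x)=1$, $\Theta_\delta(x)=0$ for all $x$. $A\subseteq B$ means $\mu_A(x)\le\mu_B(x)$ and $\gamma_A(x)\ge\gamma_B(x)$ for all $x$. $A\cap B$ is the IFS $(\min(\mu_A,\mu_B),\max(\gamma_A,\gamma_B))$ (pointwise). The product $A\circ_\Gamma B=(\mu_A\circ_\Gamma\mu_B,\gamma_A\circ_\Gamma\gamma_B)$ is given by $(\mu_A\circ_\Gamma\mu_B)(a)=\sup\{\mu_A(b)\wedge\mu_B(c)\}$ and $(\gamma_A\circ_\Gamma\gamma_B)(a)=\inf\{\gamma_A(b)\vee\gamma_B(c)\}$, over all $b,c\in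 S$, $\beta\in\Gamma$ with $a=b\beta c$, if such a factorization exists, and by $0$ and $1$ respectively otherwise. Here $\wedge=\min$, $\vee=\max$. An IFS $A$ of $S$ is an intuitionistic fuzzy: - $\Gamma$-AG-subgroupoid if $\mu_A(x\alpha y)\ge\mu_A(x)\wedge\mu_A(y)$ and $\gamma_A(x\alpha y)\le\gamma_A(x)\vee\gamma_A(y)$; - $\Gamma$-left ideal if $\mu_A(x\alpha y)\ge\mu_A(y)$ and $\gamma_A(x\alpha y)\le\gamma_A(y)$; - $\Gamma$-right ideal if $\mu_A(x\alpha y)\ge\mu_A(x)$ and $\gamma_A(x\alpha y)\le\gamma_A(x)$; - $\Gamma$-two-sided ideal if it is both a $\Gamma$-left and a $\Gamma$-right ideal (in the intuitionistic fuzzy sense); - $\Gamma$-generalized bi-ideal if $\mu_A((x\alpha a)\beta y)\ge\mu_A(x)\wedge\mu_A(y)$ and $\gamma_A((x\alpha a)\beta y)\le\gamma_A(x)\vee\gamma_A(y)$; - $\Gamma$-bi-ideal if it is both an intuitionistic fuzzy $\Gamma$-AG-subgroupoid and an intuitionistic fuzzy $\Gamma$-generalized bi-ideal; - $\Gamma$-interior ideal if $\mu_A((x\alpha a)\beta y)\ge\mu_A(a)$ and $\gamma_A((x\alpha a)\beta y)\le\gamma_A(a)$; - $\Gamma$-quasi ideal if $(A\circ_\Gamma\delta)\cap(\delta\circ_\Gamma A)\subseteq A$; where the inequalities are required for all $x,a,y\in S$ and $\alpha,\beta\in\Gamma$. *)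

theory Defs
  imports Complex_Main
begin

text \<open>The nonempty sets \<open>S\<close> and \<open>\<Gamma>\<close> are the types \<open>'a\<close> and \<open>'g\<close>; the map
  \<open>S \<times> \<Gamma> \<times> S \<rightarrow> S\<close> is the parameter \<open>m\<close>, with \<open>m x \<alpha> y\<close> for \<open>x\<alpha>y\<close>.\<close>

definition gamma_AG_groupoid :: "('a \<Rightarrow> 'g \<Rightarrow> 'a \<Rightarrow> 'a) \<Rightarrow> bool" where
  "gamma_AG_groupoid m \<longleftrightarrow> (\<forall>x y z \<alpha> \<beta>. m (m x \<alpha> y) \<beta> z = m (m z \<alpha> y) \<beta> x)"

definition gamma_AG_star_star_groupoid :: "('a \<Rightarrow> 'g \<Rightarrow> 'a \<Rightarrow> 'a) \<Rightarrow> bool" where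
  "gamma_AG_star_star_groupoid m \<longleftrightarrow>
     gamma_AG_groupoid m \<and> (\<forall>x y z \<alpha> \<beta>. m x \<alpha> (m y \<beta> z) = m y \<alpha> (m x \<beta> z))"

definition intra_regular :: "('a \<Rightarrow> 'g \<Rightarrow> 'a \<Rightarrow> 'a) \<Rightarrow> bool" where
  "intra_regular m \<longleftrightarrow> (\<forall>a. \<exists>x y \<alpha> \<beta> \<gamma>. a = m (m x \<alpha> (m a \<beta> a)) \<gamma> y)"

text \<open>Pairs (membership function, non-membership function); the range condition is
  the separate predicate \<open>is_ifs\<close>.\<close>

type_synonym 'a ifs = "('a \<Rightarrow> real) \<times> ('a \<Rightarrow> real)"

abbreviation memb :: "'a ifs \<Rightarrow> 'a \<Rightarrow> real" where "memb \<equiv> fst"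
abbreviation nonmemb :: "'a ifs \<Rightarrow> 'a \<Rightarrow> real" where "nonmemb \<equiv> snd"

definition is_ifs :: "'a ifs \<Rightarrow> bool" where
  "is_ifs A \<longleftrightarrow>
     (\<forall>x. memb A x \<in> {0..1} \<and> nonmemb A x \<in> {0..1} \<and>
          0 \<le> memb A x + nonmemb A x \<and> memb A x + nonmemb A x \<le> 1)"

definition ifs_delta :: "'a ifs" where
  "ifs_delta = (\<lambda>x. 1, \<lambda>x. 0)"

definition ifs_subset :: "'a ifs \<Rightarrow> 'a ifs \<Rightarrow> bool" where
  "ifs_subset A B \<longleftrightarrow> (\<forall>x. memb A x \<le> memb B x \<and> nonmemb A x \<ge> nonmemb B x)"

definition ifs_inter :: "'a ifs \<Rightarrow> 'a ifs \<Rightarrow> 'a ifs" where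
  "ifs_inter A B = (\<lambda>x. min (memb A x) (memb B x), \<lambda>x. max (nonmemb A x) (nonmemb B x))"

text \<open>\<open>Sup\<close> and \<open>Inf\<close> on \<open>real\<close> are the true supremum and infimum here: the sets are nonempty
  in the branches where they are used, and bounded whenever \<open>A\<close> and \<open>B\<close> satisfy \<open>is_ifs\<close>.\<close>

definition ifs_prod :: "('a \<Rightarrow> 'g \<Rightarrow> 'a \<Rightarrow> 'a) \<Rightarrow> 'a ifs \<Rightarrow> 'a ifs \<Rightarrow> 'a ifs" where
  "ifs_prod m A B =
     (\<lambda>a. if \<exists>b \<beta> c. a = m b \<beta> c
           then Sup {min (memb A b) (memb B c) | b \<beta> c. a = m b \<beta> c} else 0,
      \<lambda>a. if \<exists>b \<beta> c. a = m b \<beta> c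
           then Inf {max (nonmemb A b) (nonmemb B c) | b \<beta> c. a = m b \<beta> c} else 1)"

definition if_AG_subgroupoid :: "('a \<Rightarrow> 'g \<Rightarrow> 'a \<Rightarrow> 'a) \<Rightarrow> 'a ifs \<Rightarrow> bool" where
  "if_AG_subgroupoid m A \<longleftrightarrow>
     (\<forall>x y \<alpha>. memb A (m x \<alpha> y) \<ge> min (memb A x) (memb A y) \<and>
              nonmemb A (m x \<alpha> y) \<le> max (nonmemb A x) (nonmemb A y))"

definition if_left_ideal :: "('a \<Rightarrow> 'g \<Rightarrow> 'a \<Rightarrow> 'a) \<Rightarrow> 'a ifs \<Rightarrow> bool" where
  "if_left_ideal m A \<longleftrightarrow>
     (\<forall>x y \<alpha>. memb A (m x \<alpha> y) \<ge> memb A y \<and> nonmemb A (m x \<alpha> y) \<le> nonmemb A y)"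

definition if_right_ideal :: "('a \<Rightarrow> 'g \<Rightarrow> 'a \<Rightarrow> 'a) \<Rightarrow> 'a ifs \<Rightarrow> bool" where
  "if_right_ideal m A \<longleftrightarrow>
     (\<forall>x y \<alpha>. memb A (m x \<alpha> y) \<ge> memb A x \<and> nonmemb A (m x \<alpha> y) \<le> nonmemb A x)"

definition if_two_sided_ideal :: "('a \<Rightarrow> 'g \<Rightarrow> 'a \<Rightarrow> 'a) \<Rightarrow> 'a ifs \<Rightarrow> bool" where
  "if_two_sided_ideal m A \<longleftrightarrow> if_left_ideal m A \<and> if_right_ideal m A"

definition if_generalized_bi_ideal :: "('a \<Rightarrow> 'g \<Rightarrow> 'a \<Rightarrow> 'a) \<Rightarrow> 'a ifs \<Rightarrow> bool" where
  "if_generalized_bi_ideal m A \<longleftrightarrow>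
     (\<forall>x a y \<alpha> \<beta>. memb A (m (m x \<alpha> a) \<beta> y) \<ge> min (memb A x) (memb A y) \<and>
                  nonmemb A (m (m x \<alpha> a) \<beta> y) \<le> max (nonmemb A x) (nonmemb A y))"

definition if_bi_ideal :: "('a \<Rightarrow> 'g \<Rightarrow> 'a \<Rightarrow> 'a) \<Rightarrow> 'a ifs \<Rightarrow> bool" where
  "if_bi_ideal m A \<longleftrightarrow> if_AG_subgroupoid m A \<and> if_generalized_bi_ideal m A"

definition if_interior_ideal :: "('a \<Rightarrow> 'g \<Rightarrow> 'a \<Rightarrow> 'a) \<Rightarrow> 'a ifs \<Rightarrow> bool" where
  "if_interior_ideal m A \<longleftrightarrow>
     (\<forall>x a y \<alpha> \<beta>. memb A (m (m x \<alpha> a) \<beta> y) \<ge> memb A a \<and>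
                  nonmemb A (m (m x \<alpha> a) \<beta> y) \<le> nonmemb A a)"

definition if_quasi_ideal :: "('a \<Rightarrow> 'g \<Rightarrow> 'a \<Rightarrow> 'a) \<Rightarrow> 'a ifs \<Rightarrow> bool" where
  "if_quasi_ideal m A \<longleftrightarrow>
     ifs_subset (ifs_inter (ifs_prod m A ifs_delta) (ifs_prod m ifs_delta A)) A"

end

theory Submission
  imports Defs
begin

text \<open>Everything rests on rewriting a product \<open>s\<alpha>b\<close>. Substituting the intra-regular expression for \<open>b\<close>
  and using the medial and paramedial laws, \<open>s\<alpha>b\<close> becomes \<open>(b\<beta>b)\<alpha>(p\<gamma>q)\<close>, and from there \<open>b\<beta>t\<close>,
  \<open>(v\<beta>b)\<gamma>b\<close> and \<open>(b\<beta>t)\<gamma>b\<close>. These forms turn the quasi, interior and generalized bi-ideal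
  conditions, respectively, into the left ideal condition. Left and right ideals coincide because
  \<open>a\<alpha>b\<close> can be rewritten with \<open>a\<beta>a\<close> rightmost, and also with \<open>b\<close> leftmost.\<close>

section \<open>Invertive, medial and paramedial laws\<close>

lemma left_invertive:
  assumes "gamma_AG_star_star_groupoid m"
  shows "m (m x \<alpha> y) \<beta> z = m (m z \<alpha> y) \<beta> x"
  using assms unfolding gamma_AG_star_star_groupoid_def gamma_AG_groupoid_def by blast

lemma left_permute:
  assumes "gamma_AG_star_star_groupoid m"
  shows "m x \<alpha> (m y \<beta> z) = m y \<alpha> (m x \<beta> z)"
  using assms unfolding gamma_AG_star_star_groupoid_def by blast

text \<open>Three left inversions suffice: one moves \<open>m z \<gamma> w\<close> to the front, one
  exchanges \<open>z\<close> with \<open>y\<close> inside, and one moves the resulting block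
  back.\<close>

lemma medial:
  assumes "gamma_AG_star_star_groupoid m"
  shows "m (m x \<alpha> y) \<beta> (m z \<gamma> w) = m (m x \<alpha> z) \<beta> (m y \<gamma> w)"
proof -
  have "m (m x \<alpha> y) \<beta> (m z \<gamma> w) = m (m (m z \<gamma> w) \<alpha> y) \<beta> x" by (rule left_invertive[OF assms])
  also have "\<dots> = m (m (m y \<gamma> w) \<alpha> z) \<beta> x" by (simp only: left_invertive[OF assms, of z \<gamma> w \<alpha> y])
  also have "\<dots> = m (m x \<alpha> z) \<beta> (m y \<gamma> w)" by (rule left_invertive[OF assms])
  finally show ?thesis .
qed

text \<open>Left permutation puts \<open>x\<close>, \<open>y\<close> and \<open>w\<close> into one
  nested product, where left inversion exchanges \<open>x\<close> and \<open>w\<close>; a second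
  permutation restores the shape.\<close>

lemma paramedial:
  assumes "gamma_AG_star_star_groupoid m"
  shows "m (m x \<alpha> y) \<beta> (m z \<gamma> w) = m (m w \<alpha> y) \<beta> (m z \<gamma> x)"
proof -
  have "m (m x \<alpha> y) \<beta> (m z \<gamma> w) = m z \<beta> (m (m x \<alpha> y) \<gamma> w)" by (rule left_permute[OF assms])
  also have "\<dots> = m z \<beta> (m (m w \<alpha> y) \<gamma> x)" by (simp only: left_invertive[OF assms, of x \<alpha> y \<gamma> w])
  also have "\<dots> = m (m w \<alpha> y) \<beta> (m z \<gamma> x)" by (rule left_permute[OF assms])
  finally show ?thesis .
qed

lemma intra_regularE:
  assumes "intra_regular m"
  obtains x y \<alpha> \<beta> \<gamma> where "a = m (m x \<alpha> (m a \<beta> a)) \<gamma> y"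
  using assms unfolding intra_regular_def by blast

section \<open>Rewriting products by intra-regularity\<close>

context
  fixes m :: "'a \<Rightarrow> 'g \<Rightarrow> 'a \<Rightarrow> 'a"
  assumes S: "gamma_AG_star_star_groupoid m" and R: "intra_regular m"
begin

lemma mult_eq_square_rightmost: "\<exists>u v \<beta> \<gamma>. m a \<alpha> b = m u \<alpha> (m v \<beta> (m a \<gamma> a))"
proof -
  obtain x y \<delta> \<beta> \<gamma> where a: "a = m (m x \<delta> (m a \<beta> a)) \<gamma> y" using R by (rule intra_regularE)
  have "m a \<alpha> b = m (m b \<gamma> y) \<alpha> (m x \<delta> (m a \<beta> a))"
    by (subst a) (rule left_invertive[OF S])
  then show ?thesis by blast
qed

lemma mult_eq_right_factor_leftmost: "\<exists>c d \<beta> \<gamma>. m a \<alpha> b = m (m b \<beta> c) \<alpha> (m a \<gamma> d)"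
proof -
  obtain x y \<delta> \<beta> \<gamma> where b: "b = m (m x \<delta> (m b \<beta> b)) \<gamma> y" using R by (rule intra_regularE)
  have "m a \<alpha> b = m (m x \<delta> (m b \<beta> b)) \<alpha> (m a \<gamma> y)"
    by (subst b) (rule left_permute[OF S])
  also have "\<dots> = m (m b \<delta> (m x \<beta> b)) \<alpha> (m a \<gamma> y)"
    by (simp only: left_permute[OF S, of x \<delta> b \<beta> b])
  finally show ?thesis by blast
qed

lemma mult_eq_square_mult: "\<exists>p q \<beta> \<gamma>. m s \<alpha> b = m (m b \<beta> b) \<alpha> (m p \<gamma> q)"
proof -
  obtain x y \<delta> \<beta> \<gamma> where b: "b = m (m x \<delta> (m b \<beta> b)) \<gamma> y" using R by (rule intra_regularE)
  have "m s \<alpha> b = m (m x \<delta> (m b \<beta> b)) \<alpha> (m s \<gamma> y)"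
    by (subst b) (rule left_permute[OF S])
  also have "\<dots> = m (m y \<delta> (m b \<beta> b)) \<alpha> (m s \<gamma> x)" by (rule paramedial[OF S])
  \<comment> \<open>The medial law pairs \<open>s\<close> with \<open>y\<close> and leaves the
    square at the head of the second factor, from where left permutation lifts it out.\<close>
  also have "\<dots> = m (m y \<delta> s) \<alpha> (m (m b \<beta> b) \<gamma> x)" by (rule medial[OF S])
  also have "\<dots> = m (m b \<beta> b) \<alpha> (m (m y \<delta> s) \<gamma> x)" by (rule left_permute[OF S])
  finally show ?thesis by blast
qed

text \<open>The paramedial and medial laws collect both copies of \<open>b\<close> in the right
  factor, and left permutation lifts one to the front. The outer \<alpha> is preserved.\<close>

lemma mult_eq_swap: "\<exists>t. m s \<alpha> b = m b \<alpha> t"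
proof -
  obtain p q \<beta> \<gamma> where "m s \<alpha> b = m (m b \<beta> b) \<alpha> (m p \<gamma> q)"
    using mult_eq_square_mult by blast
  also have "\<dots> = m (m q \<beta> b) \<alpha> (m p \<gamma> b)" by (rule paramedial[OF S])
  also have "\<dots> = m (m q \<beta> p) \<alpha> (m b \<gamma> b)" by (rule medial[OF S])
  also have "\<dots> = m b \<alpha> (m (m q \<beta> p) \<gamma> b)" by (rule left_permute[OF S])
  finally show ?thesis by blast
qed

lemma mult_eq_interior: "\<exists>v \<beta>. m s \<alpha> b = m (m v \<beta> b) \<alpha> b"
proof -
  obtain p q \<beta> \<gamma> where "m s \<alpha> b = m (m b \<beta> b) \<alpha> (m p \<gamma> q)"
    using mult_eq_square_mult by blast
  also have "\<dots> = m (m (m p \<gamma> q) \<beta> b) \<alpha> b" by (rule left_invertive[OF S])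
  finally show ?thesis by blast
qed

text \<open>Swapping the inner product \<open>m v \<beta> b\<close> puts \<open>b\<close> at both
  ends, so that the \<open>min\<close> and \<open>max\<close> of the generalized bi-ideal condition
  collapse to the value at \<open>b\<close>.\<close>

lemma mult_eq_sandwich: "\<exists>t \<beta>. m s \<alpha> b = m (m b \<beta> t) \<alpha> b"
  using mult_eq_interior[of s \<alpha> b] mult_eq_swap by metis

text \<open>This factorization of \<open>a\<close> makes the product of \<open>ifs_delta\<close>
  with \<open>A\<close> at least as large as \<open>A\<close>.\<close>

lemma eq_mult_self: "\<exists>v \<beta>. a = m v \<beta> a"
proof -
  obtain x y \<delta> \<beta> \<gamma> where a: "a = m (m x \<delta> (m a \<beta> a)) \<gamma> y" using R by (rule intra_regularE)
  also have "\<dots> = m (m a \<delta> (m x \<beta> a)) \<gamma> y" by (simp only: left_permute[OF S, of x \<delta> a \<beta> a])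
  also have "\<dots> = m (m y \<delta> (m x \<beta> a)) \<gamma> a" by (rule left_invertive[OF S])
  finally show ?thesis by blast
qed

lemma eq_self_mult: "\<exists>v \<beta>. a = m a \<beta> v"
  using eq_mult_self mult_eq_swap by metis

section \<open>Implications between the ideal conditions\<close>

lemma left_ideal_imp_right_ideal:
  assumes "if_left_ideal m A" shows "if_right_ideal m A"
  unfolding if_right_ideal_def
proof (intro allI)
  fix a b \<alpha>
  obtain u v \<beta> \<gamma> where ab: "m a \<alpha> b = m u \<alpha> (m v \<beta> (m a \<gamma> a))"
    using mult_eq_square_rightmost by blast
  \<comment> \<open>The left ideal inequality is applied three times, discarding \<open>u\<close>,
    then \<open>v\<close>, then one copy of \<open>a\<close>.\<close>
  show "memb A (m a \<alpha> b) \<ge> memb A a \<and> nonmemb A (m a \<alpha> b) \<le> nonmemb A a"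
    using assms unfolding ab if_left_ideal_def by (meson order_trans)
qed

lemma right_ideal_imp_left_ideal:
  assumes "if_right_ideal m A" shows "if_left_ideal m A"
  unfolding if_left_ideal_def
proof (intro allI)
  fix a b \<alpha>
  obtain c d \<beta> \<gamma> where ab: "m a \<alpha> b = m (m b \<beta> c) \<alpha> (m a \<gamma> d)"
    using mult_eq_right_factor_leftmost by blast
  \<comment> \<open>The right ideal inequality discards \<open>m a \<gamma> d\<close>, then
    \<open>c\<close>.\<close>
  show "memb A (m a \<alpha> b) \<ge> memb A b \<and> nonmemb A (m a \<alpha> b) \<le> nonmemb A b"
    using assms unfolding ab if_right_ideal_def by (meson order_trans)
qed

lemma generalized_bi_ideal_imp_left_ideal:
  assumes "if_generalized_bi_ideal m A" shows "if_left_ideal m A"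
  unfolding if_left_ideal_def
proof (intro allI)
  fix s b \<alpha>
  obtain t \<beta> where "m s \<alpha> b = m (m b \<beta> t) \<alpha> b" using mult_eq_sandwich by blast
  then show "memb A (m s \<alpha> b) \<ge> memb A b \<and> nonmemb A (m s \<alpha> b) \<le> nonmemb A b"
    using assms unfolding if_generalized_bi_ideal_def by (metis min.idem max.idem)
qed

lemma interior_ideal_imp_left_ideal:
  assumes "if_interior_ideal m A" shows "if_left_ideal m A"
  unfolding if_left_ideal_def
proof (intro allI)
  fix s b \<alpha>
  obtain v \<beta> where "m s \<alpha> b = m (m v \<beta> b) \<alpha> b" using mult_eq_interior by blast
  then show "memb A (m s \<alpha> b) \<ge> memb A b \<and> nonmemb A (m s \<alpha> b) \<le> nonmemb A b"
    using assms unfolding if_interior_ideal_def by metis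
qed

end

lemma two_sided_ideal_imp_bi_ideal:
  assumes "if_two_sided_ideal m A" shows "if_bi_ideal m A"
proof -
  have mu: "memb A x \<le> memb A (m x \<alpha> y)" and nu: "nonmemb A (m x \<alpha> y) \<le> nonmemb A x"
    for x y \<alpha> using assms unfolding if_two_sided_ideal_def if_right_ideal_def by auto
  show ?thesis
    unfolding if_bi_ideal_def if_AG_subgroupoid_def if_generalized_bi_ideal_def
    by (meson mu nu min.coboundedI1 max.coboundedI1 order_trans)
qed

lemma two_sided_ideal_imp_interior_ideal:
  assumes "if_two_sided_ideal m A" shows "if_interior_ideal m A"
  using assms
  unfolding if_two_sided_ideal_def if_left_ideal_def if_right_ideal_def if_interior_ideal_def
  by (meson order_trans)

section \<open>Products of intuitionistic fuzzy sets\<close>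

lemma is_ifs_delta: "is_ifs ifs_delta"
  by (simp add: is_ifs_def ifs_delta_def)

lemma ifs_subset_antisym: "ifs_subset A B \<Longrightarrow> ifs_subset B A \<Longrightarrow> A = B"
  by (simp add: ifs_subset_def prod_eq_iff fun_eq_iff order_antisym)

text \<open>The given factorization is one of those over which \<open>Sup\<close> and
  \<open>Inf\<close> range; the range condition supplies the bounds 1 and 0 that make these real
  operators usable.\<close>

lemma ifs_prod_mult:
  assumes "is_ifs A" and "is_ifs B"
  shows "min (memb A b) (memb B c) \<le> memb (ifs_prod m A B) (m b \<beta> c)"
    and "nonmemb (ifs_prod m A B) (m b \<beta> c) \<le> max (nonmemb A b) (nonmemb B c)"
proof -
  let ?M = "{min (memb A b') (memb B c') | b' \<beta>' c'. m b \<beta> c = m b' \<beta>' c'}"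
  let ?N = "{max (nonmemb A b') (nonmemb B c') | b' \<beta>' c'. m b \<beta> c = m b' \<beta>' c'}"
  have "bdd_above ?M"
    using assms by (intro bdd_aboveI[of _ 1]) (auto simp: is_ifs_def min_le_iff_disj)
  then have "min (memb A b) (memb B c) \<le> Sup ?M" by (intro cSup_upper) auto
  then show "min (memb A b) (memb B c) \<le> memb (ifs_prod m A B) (m b \<beta> c)"
    unfolding ifs_prod_def by auto
  have "bdd_below ?N"
    using assms by (intro bdd_belowI[of _ 0]) (auto simp: is_ifs_def le_max_iff_disj)
  then have "Inf ?N \<le> max (nonmemb A b) (nonmemb B c)" by (intro cInf_lower) auto
  then show "nonmemb (ifs_prod m A B) (m b \<beta> c) \<le> max (nonmemb A b) (nonmemb B c)"
    unfolding ifs_prod_def by auto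
qed

lemma ifs_prod_subsetI:
  assumes "is_ifs C"
    and "\<And>b \<beta> c. min (memb A b) (memb B c) \<le> memb C (m b \<beta> c)"
    and "\<And>b \<beta> c. nonmemb C (m b \<beta> c) \<le> max (nonmemb A b) (nonmemb B c)"
  shows "ifs_subset (ifs_prod m A B) C"
  unfolding ifs_subset_def
proof (intro allI)
  fix a
  show "memb (ifs_prod m A B) a \<le> memb C a \<and> nonmemb C a \<le> nonmemb (ifs_prod m A B) a"
  proof (cases "\<exists>b \<beta> c. a = m b \<beta> c")
    case True
    have "Sup {min (memb A b) (memb B c) | b \<beta> c. a = m b \<beta> c} \<le> memb C a"
      by (rule cSup_least) (use True assms(2) in blast)+
    moreover have "nonmemb C a \<le> Inf {max (nonmemb A b) (nonmemb B c) | b \<beta> c. a = m b \<beta> c}"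
      by (rule cInf_greatest) (use True assms(3) in blast)+
    ultimately show ?thesis using True by (simp add: ifs_prod_def)
  next
    case False
    \<comment> \<open>Without a factorization the product has the default values 0 and 1, which are
      extreme in the unit interval.\<close>
    with assms(1) show ?thesis by (auto simp: ifs_prod_def is_ifs_def)
  qed
qed

context
  fixes m :: "'a \<Rightarrow> 'g \<Rightarrow> 'a \<Rightarrow> 'a" and A :: "'a ifs"
  assumes A: "is_ifs A"
begin

text \<open>The values 1 and 0 of \<open>ifs_delta\<close> are neutral for \<open>min\<close> and
  \<open>max\<close> on the unit interval.\<close>

lemma ifs_prod_delta_mult:
  "memb A b \<le> memb (ifs_prod m A ifs_delta) (m b \<beta> c)"
  "nonmemb (ifs_prod m A ifs_delta) (m b \<beta> c) \<le> nonmemb A b"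
  using ifs_prod_mult[OF A is_ifs_delta, where b = b and c = c and m = m and \<beta> = \<beta>] A
  by (simp_all add: ifs_delta_def is_ifs_def min.absorb1 min.absorb2 max.absorb1 max.absorb2)

lemma ifs_delta_prod_mult:
  "memb A c \<le> memb (ifs_prod m ifs_delta A) (m b \<beta> c)"
  "nonmemb (ifs_prod m ifs_delta A) (m b \<beta> c) \<le> nonmemb A c"
  using ifs_prod_mult[OF is_ifs_delta A, where b = b and c = c and m = m and \<beta> = \<beta>] A
  by (simp_all add: ifs_delta_def is_ifs_def min.absorb1 min.absorb2 max.absorb1 max.absorb2)

lemma right_ideal_imp_prod_delta_subset:
  "if_right_ideal m A \<Longrightarrow> ifs_subset (ifs_prod m A ifs_delta) A"
  by (rule ifs_prod_subsetI[OF A])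
    (auto simp: if_right_ideal_def ifs_delta_def min_le_iff_disj le_max_iff_disj)

lemma left_ideal_imp_delta_prod_subset:
  "if_left_ideal m A \<Longrightarrow> ifs_subset (ifs_prod m ifs_delta A) A"
  by (rule ifs_prod_subsetI[OF A])
    (auto simp: if_left_ideal_def ifs_delta_def min_le_iff_disj le_max_iff_disj)

text \<open>The intersection lies below its first component, which is already contained in
  \<open>A\<close>.\<close>

lemma right_ideal_imp_quasi_ideal:
  assumes "if_right_ideal m A" shows "if_quasi_ideal m A"
  using right_ideal_imp_prod_delta_subset[OF assms]
  unfolding if_quasi_ideal_def ifs_subset_def ifs_inter_def
  by (auto simp: min_le_iff_disj le_max_iff_disj)

lemma delta_prod_eq_imp_left_ideal:
  assumes "ifs_prod m ifs_delta A = A" shows "if_left_ideal m A"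
  using ifs_delta_prod_mult unfolding if_left_ideal_def assms by blast

lemma quasi_ideal_imp_left_ideal:
  assumes S: "gamma_AG_star_star_groupoid m" and R: "intra_regular m"
    and Q: "if_quasi_ideal m A"
  shows "if_left_ideal m A"
  unfolding if_left_ideal_def
proof (intro allI)
  fix s b \<alpha>
  obtain t where t: "m s \<alpha> b = m b \<alpha> t" using mult_eq_swap[OF S R] by blast
  let ?P = "ifs_inter (ifs_prod m A ifs_delta) (ifs_prod m ifs_delta A)"
  \<comment> \<open>Each component of \<open>?P\<close> is bounded through its own factorization of
    the same element: \<open>m b \<alpha> t\<close> for the first, \<open>m s \<alpha> b\<close> for
    the second.\<close>
  have "memb A b \<le> memb ?P (m s \<alpha> b)" "nonmemb ?P (m s \<alpha> b) \<le> nonmemb A b"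
    using ifs_prod_delta_mult[where b = b and \<beta> = \<alpha> and c = t] ifs_delta_prod_mult[where b = s and \<beta> = \<alpha> and c = b]
    by (simp_all add: ifs_inter_def t)
  with Q show "memb A (m s \<alpha> b) \<ge> memb A b \<and> nonmemb A (m s \<alpha> b) \<le> nonmemb A b"
    unfolding if_quasi_ideal_def ifs_subset_def by (meson order_trans)
qed

lemma subset_prod_delta:
  assumes "gamma_AG_star_star_groupoid m" and "intra_regular m"
  shows "ifs_subset A (ifs_prod m A ifs_delta)"
  unfolding ifs_subset_def using ifs_prod_delta_mult eq_self_mult[OF assms] by metis

lemma subset_delta_prod:
  assumes "gamma_AG_star_star_groupoid m" and "intra_regular m"
  shows "ifs_subset A (ifs_prod m ifs_delta A)"
  unfolding ifs_subset_def using ifs_delta_prod_mult eq_mult_self[OF assms] by metis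

end

theorem theorem7:
  fixes m :: "'a \<Rightarrow> 'g \<Rightarrow> 'a \<Rightarrow> 'a" and A :: "'a ifs"
  assumes "gamma_AG_star_star_groupoid m"
    and "intra_regular m"
    and "is_ifs A"
  shows "(if_left_ideal m A \<longleftrightarrow> if_right_ideal m A) \<and>
         (if_right_ideal m A \<longleftrightarrow> if_two_sided_ideal m A) \<and>
         (if_two_sided_ideal m A \<longleftrightarrow> if_bi_ideal m A) \<and>
         (if_bi_ideal m A \<longleftrightarrow> if_generalized_bi_ideal m A) \<and>
         (if_generalized_bi_ideal m A \<longleftrightarrow> if_interior_ideal m A) \<and>
         (if_interior_ideal m A \<longleftrightarrow> if_quasi_ideal m A) \<and>
         (if_quasi_ideal m A \<longleftrightarrow> ifs_prod m A ifs_delta = A \<and> ifs_prod m ifs_delta A = A)"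
proof -
  note S = assms(1) and R = assms(2) and A = assms(3)
  \<comment> \<open>Every condition is compared with the left ideal condition, so the chain of
    equivalences follows by substitution.\<close>
  have right: "if_right_ideal m A \<longleftrightarrow> if_left_ideal m A"
    using left_ideal_imp_right_ideal[OF S R] right_ideal_imp_left_ideal[OF S R] by blast
  then have two: "if_two_sided_ideal m A \<longleftrightarrow> if_left_ideal m A"
    by (auto simp: if_two_sided_ideal_def)
  have bi: "if_bi_ideal m A \<longleftrightarrow> if_left_ideal m A"
    and gbi: "if_generalized_bi_ideal m A \<longleftrightarrow> if_left_ideal m A"
    using two two_sided_ideal_imp_bi_ideal generalized_bi_ideal_imp_left_ideal[OF S R]
    unfolding if_bi_ideal_def by blast+
  have interior: "if_interior_ideal m A \<longleftrightarrow> if_left_ideal m A"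
    using two two_sided_ideal_imp_interior_ideal interior_ideal_imp_left_ideal[OF S R] by blast
  have quasi: "if_quasi_ideal m A \<longleftrightarrow> if_left_ideal m A"
    using right right_ideal_imp_quasi_ideal[OF A] quasi_ideal_imp_left_ideal[OF A S R] by blast
  \<comment> \<open>The ideal inequalities bound both products by \<open>A\<close>; the reverse
    inclusions come from factorizing each element through itself.\<close>
  have fixpt: "ifs_prod m A ifs_delta = A \<and> ifs_prod m ifs_delta A = A \<longleftrightarrow> if_left_ideal m A"
    using right delta_prod_eq_imp_left_ideal[OF A]
      ifs_subset_antisym[OF right_ideal_imp_prod_delta_subset[OF A] subset_prod_delta[OF A S R]]
      ifs_subset_antisym[OF left_ideal_imp_delta_prod_subset[OF A] subset_delta_prod[OF A S R]]
    by blast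
  show ?thesis
    unfolding right two bi gbi interior quasi fixpt by simp
qed

end
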